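(* $\mathbf{IL}\mathsf{B_0}\vdash\mathsf{Z}$; that is, for all formulas $A,B\in\mathsf{BS}_1$, the formula $$(A\equiv B)\to (A\rhd A\wedge B)$$ is a theorem of the logic $\mathbf{IL}\mathsf{B_0}$.
   Context: Modal interpretability formulas $\mathcal A$ are built from propositional variables and $\bot$ using $\wedge,\to$, a unary modality $\Box$ and a binary modality $\rhd$; $\neg,\vee,\top,\Diamond=\neg\Box\neg$ are the usual abbreviations. $\rhd$ binds weaker than $\wedge,\vee$ and stronger than $\to$. $A\equiv B$ abbreviates $(A\rhd B)\wedge(B\rhd A)$. $\mathbf{IL}$ is the smallest set of formulas containing all propositional tautologies and all instances of (L1) $\Box(A\to B)\to(\Box A\to\Box B)$; (L2) $\Box A\to\Box\Box A$; (L3) $\Box(\Box A\to A)\to\Box A$; (J1) $\Box(A\to B)\to A\rhd B$; (J2) $(A\rhd B)\wedge(B\rhd C)\to A\rhd C$; (J3) $(A\rhd C)\wedge(B\rhd C)\to A\vee B\rhd C$; (J4) $A\rhd B\to(\Diamond A\to\Diamond B)$; (J5) $\Diamond A\rhd A$; and closed under Necessitation and Modus Ponens. The class $\mathsf{BS}_1$ consists of boolean combinations of boxed formulas: $\mathsf{BS}_1::=\Box\mathcal A\mid\neg\mathsf{BS}_1\mid\mathsf{BS}_1\wedge\mathsf{BS}_1\mid\mathsf{BS}_1\vee\mathsf{BS}_1$, where $\mathcal A$ ranges over all modal interpretability formulas. $\mathsf{B_0}$ is the schema $A\rhd B\to A\wedge\Box C\rhd B\wedge\Box C$ for $A\in\mathsf{BS}_1$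 and arbitrary formulas $B,C$. $\mathbf{IL}\mathsf{B_0}$ is the logic extending $\mathbf{IL}$ with all instances of $\mathsf{B_0}$ (closed under Necessitation and Modus Ponens). *)

theory Defs
  imports Main
begin

text \<open>The type variable \<open>'v\<close> is the type of propositional variables.\<close>

datatype 'v fm =
    Var 'v
  | Bot  (\<open>\<^bold>\<bottom>\<close>)
  | And "'v fm" "'v fm"  (infixr \<open>\<^bold>\<and>\<close> 75)
  | Imp "'v fm" "'v fm"  (infixr \<open>\<^bold>\<longrightarrow>\<close> 55)
  | Box "'v fm"  (\<open>\<^bold>\<box> _\<close> [90] 90)
  | Rhd "'v fm" "'v fm"  (infix \<open>\<rhd>\<close> 60)

abbreviation Neg :: "'v fm \<Rightarrow> 'v fm"  (\<open>\<^bold>\<not> _\<close> [90] 90) where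
  "\<^bold>\<not> A \<equiv> Imp A Bot"

abbreviation Or :: "'v fm \<Rightarrow> 'v fm \<Rightarrow> 'v fm"  (infixr \<open>\<^bold>\<or>\<close> 70) where
  "A \<^bold>\<or> B \<equiv> Imp (\<^bold>\<not> A) B"

abbreviation Dia :: "'v fm \<Rightarrow> 'v fm"  (\<open>\<^bold>\<diamond> _\<close> [90] 90) where
  "\<^bold>\<diamond> A \<equiv> \<^bold>\<not> \<^bold>\<box> \<^bold>\<not> A"

text \<open>Mutual interpretability, written \<open>A \<equiv> B\<close> in the literature; it is not the
  biconditional.\<close>

abbreviation Equi :: "'v fm \<Rightarrow> 'v fm \<Rightarrow> 'v fm"  (infix \<open>\<^bold>\<equiv>\<close> 60) where
  "A \<^bold>\<equiv> B \<equiv> And (Rhd A B) (Rhd B A)"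

text \<open>For the notion of tautology, formulas whose main connective is a modality are
  propositional atoms, just like variables: \<open>v\<close> assigns a truth value to each of them.\<close>

primrec peval :: "('v fm \<Rightarrow> bool) \<Rightarrow> 'v fm \<Rightarrow> bool" where
  "peval v (Var p) = v (Var p)"
| "peval v Bot = False"
| "peval v (A \<^bold>\<and> B) = (peval v A \<and> peval v B)"
| "peval v (A \<^bold>\<longrightarrow> B) = (peval v A \<longrightarrow> peval v B)"
| "peval v (\<^bold>\<box> A) = v (\<^bold>\<box> A)"
| "peval v (A \<rhd> B) = v (A \<rhd> B)"

definition tautology :: "'v fm \<Rightarrow> bool" where
  "tautology A \<longleftrightarrow> (\<forall>v. peval v A)"

text \<open>The extension of \<open>IL\<close> by the formulas in \<open>X\<close> as additional axioms.\<close>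

inductive_set IL_ext :: "'v fm set \<Rightarrow> 'v fm set" for X :: "'v fm set" where
  taut: "tautology A \<Longrightarrow> A \<in> IL_ext X"
| L1: "\<^bold>\<box> (A \<^bold>\<longrightarrow> B) \<^bold>\<longrightarrow> (\<^bold>\<box> A \<^bold>\<longrightarrow> \<^bold>\<box> B) \<in> IL_ext X"
| L2: "\<^bold>\<box> A \<^bold>\<longrightarrow> \<^bold>\<box> \<^bold>\<box> A \<in> IL_ext X"
| L3: "\<^bold>\<box> (\<^bold>\<box> A \<^bold>\<longrightarrow> A) \<^bold>\<longrightarrow> \<^bold>\<box> A \<in> IL_ext X"
| J1: "\<^bold>\<box> (A \<^bold>\<longrightarrow> B) \<^bold>\<longrightarrow> A \<rhd> B \<in> IL_ext X"
| J2: "(A \<rhd> B) \<^bold>\<and> (B \<rhd> C) \<^bold>\<longrightarrow> A \<rhd> C \<in> IL_ext X"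
| J3: "(A \<rhd> C) \<^bold>\<and> (B \<rhd> C) \<^bold>\<longrightarrow> A \<^bold>\<or> B \<rhd> C \<in> IL_ext X"
| J4: "A \<rhd> B \<^bold>\<longrightarrow> (\<^bold>\<diamond> A \<^bold>\<longrightarrow> \<^bold>\<diamond> B) \<in> IL_ext X"
| J5: "\<^bold>\<diamond> A \<rhd> A \<in> IL_ext X"
| extra: "A \<in> X \<Longrightarrow> A \<in> IL_ext X"
| Nec: "A \<in> IL_ext X \<Longrightarrow> \<^bold>\<box> A \<in> IL_ext X"
| MP: "A \<^bold>\<longrightarrow> B \<in> IL_ext X \<Longrightarrow> A \<in> IL_ext X \<Longrightarrow> B \<in> IL_ext X"

definition IL :: "'v fm set" where
  "IL = IL_ext {}"

inductive_set BS1 :: "'v fm set" where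
  Box: "\<^bold>\<box> A \<in> BS1"
| Neg: "A \<in> BS1 \<Longrightarrow> \<^bold>\<not> A \<in> BS1"
| And: "A \<in> BS1 \<Longrightarrow> B \<in> BS1 \<Longrightarrow> A \<^bold>\<and> B \<in> BS1"
| Or: "A \<in> BS1 \<Longrightarrow> B \<in> BS1 \<Longrightarrow> A \<^bold>\<or> B \<in> BS1"

definition B0 :: "'v fm set" where
  "B0 = {A \<rhd> B \<^bold>\<longrightarrow> A \<^bold>\<and> \<^bold>\<box> C \<rhd> B \<^bold>\<and> \<^bold>\<box> C | A B C. A \<in> BS1}"

definition ILB0 :: "'v fm set" where
  "ILB0 = IL_ext B0"

end

theory Submission
  imports Defs
begin

text \<open>Think of a truth assignment to the finitely many boxed formulas \<open>\<^bold>\<box> C\<close> from which \<open>A\<close> and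
  \<open>B\<close> are built as a state. Given mutually interpretable \<open>A\<close> and \<open>B\<close>, interpreting \<open>A\<close> in \<open>B\<close>
  and \<open>B\<close> in \<open>A\<close> preserves, by \<open>B0\<close>, every box that is already true. Start in a state of \<open>A\<close>.
  If \<open>B\<close> holds there too, we are done. If not, pass to a state of \<open>B\<close>: all true boxes remain
  true, and as \<open>B\<close> was false before, the state has changed, so at least one box has become true.
  Now go back to \<open>A\<close>, and so on. As there are only finitely many boxes, this process ends, and it
  can only end in a state of \<open>A \<^bold>\<and> B\<close>.

  The formal counterpart is an induction on the set \<open>K\<close> of boxes that are still undecided. Turning
  \<open>\<^bold>\<box> C\<close> true means replacing \<open>A\<close> and \<open>B\<close> by \<open>A \<^bold>\<and> \<^bold>\<box> C\<close> and \<open>B \<^bold>\<and> \<^bold>\<box> C\<close>: these are again in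
  \<open>BS1\<close>, they are mutually interpretable by \<open>B0\<close>, and \<open>C\<close> is now decided. So only the state in
  which all boxes of \<open>K\<close> are false needs an argument (\<open>interprets_conjunction\<close>). The case
  distinction over which box becomes true is made inside the logic by J3
  (\<open>rhd_finite_cases\<close>).\<close>

section \<open>Reasoning under a hypothesis\<close>

text \<open>The hypothesis \<open>E\<close> below will be the mutual interpretability of \<open>A\<close> and \<open>B\<close>. Nothing has
  to be necessitated under it, so derivability from \<open>E\<close> can be expressed by an implication.\<close>

lemma theorem_under_hyp:
  assumes "F \<in> IL_ext X"
  shows "E \<^bold>\<longrightarrow> F \<in> IL_ext X"
proof -
  have "F \<^bold>\<longrightarrow> (E \<^bold>\<longrightarrow> F) \<in> IL_ext X"
    by (rule IL_ext.taut) (simp add: tautology_def)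
  then show ?thesis
    using assms by (rule IL_ext.MP)
qed

lemma MP_under_hyp:
  assumes "E \<^bold>\<longrightarrow> (F \<^bold>\<longrightarrow> G) \<in> IL_ext X" and "E \<^bold>\<longrightarrow> F \<in> IL_ext X"
  shows "E \<^bold>\<longrightarrow> G \<in> IL_ext X"
proof -
  have "(E \<^bold>\<longrightarrow> (F \<^bold>\<longrightarrow> G)) \<^bold>\<longrightarrow> ((E \<^bold>\<longrightarrow> F) \<^bold>\<longrightarrow> (E \<^bold>\<longrightarrow> G)) \<in> IL_ext X"
    by (rule IL_ext.taut) (simp add: tautology_def)
  then show ?thesis
    using assms by (blast intro: IL_ext.MP)
qed

lemma conj_under_hyp:
  assumes "E \<^bold>\<longrightarrow> F \<in> IL_ext X" and "E \<^bold>\<longrightarrow> G \<in> IL_ext X"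
  shows "E \<^bold>\<longrightarrow> F \<^bold>\<and> G \<in> IL_ext X"
proof -
  have "F \<^bold>\<longrightarrow> (G \<^bold>\<longrightarrow> F \<^bold>\<and> G) \<in> IL_ext X"
    by (rule IL_ext.taut) (simp add: tautology_def)
  then show ?thesis
    using assms by (blast intro: MP_under_hyp theorem_under_hyp)
qed

lemma rhd_if_entails:
  assumes "\<And>v. peval v A \<Longrightarrow> peval v B"
  shows "E \<^bold>\<longrightarrow> A \<rhd> B \<in> IL_ext X"
proof -
  have "A \<^bold>\<longrightarrow> B \<in> IL_ext X"
    by (rule IL_ext.taut) (simp add: tautology_def assms)
  then show ?thesis
    by (blast intro: theorem_under_hyp IL_ext.Nec IL_ext.J1 IL_ext.MP)
qed

lemma rhd_trans:
  assumes "E \<^bold>\<longrightarrow> A \<rhd> B \<in> IL_ext X" and "E \<^bold>\<longrightarrow> B \<rhd> C \<in> IL_ext X"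
  shows "E \<^bold>\<longrightarrow> A \<rhd> C \<in> IL_ext X"
  using assms by (blast intro: conj_under_hyp MP_under_hyp theorem_under_hyp IL_ext.J2)

lemma rhd_disj:
  assumes "E \<^bold>\<longrightarrow> A \<rhd> C \<in> IL_ext X" and "E \<^bold>\<longrightarrow> B \<rhd> C \<in> IL_ext X"
  shows "E \<^bold>\<longrightarrow> A \<^bold>\<or> B \<rhd> C \<in> IL_ext X"
  using assms by (blast intro: conj_under_hyp MP_under_hyp theorem_under_hyp IL_ext.J3)

text \<open>J3 for a finite number of cases. Disposing of a case \<open>F C\<close> leaves \<open>A \<^bold>\<and> \<^bold>\<not> F C\<close> to be
  covered by the others, which avoids an explicit finite disjunction of formulas.\<close>

lemma rhd_finite_cases:
  assumes "finite K"
    and "\<And>v. peval v A \<Longrightarrow> peval v D \<or> (\<exists>C\<in>K. peval v (F C))"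
    and "\<And>C. C \<in> K \<Longrightarrow> E \<^bold>\<longrightarrow> F C \<rhd> D \<in> IL_ext X"
  shows "E \<^bold>\<longrightarrow> A \<rhd> D \<in> IL_ext X"
  using assms
proof (induction K arbitrary: A rule: finite_induct)
  case empty
  then show ?case
    by (simp add: rhd_if_entails)
next
  case (insert C K)
  have "E \<^bold>\<longrightarrow> A \<^bold>\<and> \<^bold>\<not> F C \<rhd> D \<in> IL_ext X"
  proof (rule insert.IH)
    fix v
    assume "peval v (A \<^bold>\<and> \<^bold>\<not> F C)"
    then show "peval v D \<or> (\<exists>C'\<in>K. peval v (F C'))"
      using insert.prems(1)[of v] by auto
  qed (simp add: insert.prems(2))
  then have "E \<^bold>\<longrightarrow> (A \<^bold>\<and> \<^bold>\<not> F C) \<^bold>\<or> F C \<rhd> D \<in> IL_ext X"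
    by (rule rhd_disj) (simp add: insert.prems(2))
  moreover have "E \<^bold>\<longrightarrow> A \<rhd> (A \<^bold>\<and> \<^bold>\<not> F C) \<^bold>\<or> F C \<in> IL_ext X"
    by (rule rhd_if_entails) simp
  ultimately show ?case
    by (blast intro: rhd_trans)
qed

section \<open>Raising boxes\<close>

lemma BS1_finitely_determined:
  assumes "A \<in> BS1"
  obtains K where "finite K"
    and "\<And>v w. \<forall>C\<in>K. v (\<^bold>\<box> C) \<longleftrightarrow> w (\<^bold>\<box> C) \<Longrightarrow> peval v A \<longleftrightarrow> peval w A"
proof -
  have "\<exists>K. finite K \<and>
    (\<forall>v w. (\<forall>C\<in>K. v (\<^bold>\<box> C) \<longleftrightarrow> w (\<^bold>\<box> C)) \<longrightarrow> (peval v A \<longleftrightarrow> peval w A))"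
    using assms
  proof (induction rule: BS1.induct)
    case (Box A)
    show ?case
      by (rule exI[of _ "{A}"]) simp
  next
    case (Neg A)
    then show ?case
      by simp
  next
    case (And A B)
    then obtain K L where "finite K" "finite L"
      "\<forall>v w. (\<forall>C\<in>K. v (\<^bold>\<box> C) \<longleftrightarrow> w (\<^bold>\<box> C)) \<longrightarrow> (peval v A \<longleftrightarrow> peval w A)"
      "\<forall>v w. (\<forall>C\<in>L. v (\<^bold>\<box> C) \<longleftrightarrow> w (\<^bold>\<box> C)) \<longrightarrow> (peval v B \<longleftrightarrow> peval w B)"
      by auto
    then show ?case
      by (intro exI[of _ "K \<union> L"]) (simp add: ball_Un, blast)
  next
    case (Or A B)
    then obtain K L where "finite K" "finite L"
      "\<forall>v w. (\<forall>C\<in>K. v (\<^bold>\<box> C) \<longleftrightarrow> w (\<^bold>\<box> C)) \<longrightarrow> (peval v A \<longleftrightarrow> peval w A)"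
      "\<forall>v w. (\<forall>C\<in>L. v (\<^bold>\<box> C) \<longleftrightarrow> w (\<^bold>\<box> C)) \<longrightarrow> (peval v B \<longleftrightarrow> peval w B)"
      by auto
    then show ?case
      by (intro exI[of _ "K \<union> L"]) (simp add: ball_Un, blast)
  qed
  then show ?thesis
    using that by blast
qed

lemma rhd_add_box:
  assumes "B0 \<subseteq> X" and "A \<in> BS1" and "E \<^bold>\<longrightarrow> A \<rhd> B \<in> IL_ext X"
  shows "E \<^bold>\<longrightarrow> A \<^bold>\<and> \<^bold>\<box> C \<rhd> B \<^bold>\<and> \<^bold>\<box> C \<in> IL_ext X"
proof -
  have "A \<rhd> B \<^bold>\<longrightarrow> A \<^bold>\<and> \<^bold>\<box> C \<rhd> B \<^bold>\<and> \<^bold>\<box> C \<in> B0"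
    using assms(2) by (auto simp: B0_def)
  then have "A \<rhd> B \<^bold>\<longrightarrow> A \<^bold>\<and> \<^bold>\<box> C \<rhd> B \<^bold>\<and> \<^bold>\<box> C \<in> IL_ext X"
    using assms(1) by (blast intro: IL_ext.extra)
  then show ?thesis
    using assms(3) by (blast intro: MP_under_hyp theorem_under_hyp)
qed

text \<open>The last premise says that \<open>K\<close> contains all undecided boxes, but it compares only
  valuations that satisfy \<open>A\<close> or \<open>B\<close>. This relativisation is what lets \<open>C\<close> be dropped from \<open>K\<close>
  once \<open>\<^bold>\<box> C\<close> is a conjunct of both formulas.

  By induction every case in which some box of \<open>K\<close> is true is settled, for \<open>A\<close> and, by symmetry,
  for \<open>B\<close>. If the state with all boxes of \<open>K\<close> false does not make \<open>A\<close> true and \<open>B\<close> false, then it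
  is harmless to \<open>A\<close>. If it does, it cannot be a state of \<open>B\<close>, so \<open>B\<close> consists of settled cases
  only, and \<open>A \<rhd> B\<close> finishes the proof.\<close>

lemma interprets_conjunction:
  assumes "B0 \<subseteq> X" and "finite K"
    and "A \<in> BS1" and "B \<in> BS1"
    and "E \<^bold>\<longrightarrow> A \<rhd> B \<in> IL_ext X" and "E \<^bold>\<longrightarrow> B \<rhd> A \<in> IL_ext X"
    and "\<And>v w. \<forall>C\<in>K. v (\<^bold>\<box> C) \<longleftrightarrow> w (\<^bold>\<box> C) \<Longrightarrow>
      peval v (A \<^bold>\<or> B) \<Longrightarrow> peval w (A \<^bold>\<or> B) \<Longrightarrow>
      (peval v A \<longleftrightarrow> peval w A) \<and> (peval v B \<longleftrightarrow> peval w B)"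
  shows "E \<^bold>\<longrightarrow> A \<rhd> A \<^bold>\<and> B \<in> IL_ext X"
  using assms(2-)
proof (induction K arbitrary: A B rule: finite_psubset_induct)
  case (psubset K)
  note AB = psubset.prems(1-4) and determined = psubset.prems(5)

  \<comment> \<open>Stated for \<open>P\<close> and \<open>Q\<close> so that it serves with \<open>A\<close> and \<open>B\<close> in either order.\<close>
  have box_true: "E \<^bold>\<longrightarrow> P \<^bold>\<and> \<^bold>\<box> C \<rhd> A \<^bold>\<and> B \<in> IL_ext X"
    if "C \<in> K" and PQ: "P = A \<and> Q = B \<or> P = B \<and> Q = A" for C P Q
  proof -
    let ?P = "P \<^bold>\<and> \<^bold>\<box> C" and ?Q = "Q \<^bold>\<and> \<^bold>\<box> C"
    have BS1: "P \<in> BS1" "Q \<in> BS1"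
      and rhd: "E \<^bold>\<longrightarrow> P \<rhd> Q \<in> IL_ext X" "E \<^bold>\<longrightarrow> Q \<rhd> P \<in> IL_ext X"
      using PQ AB by auto
    have "E \<^bold>\<longrightarrow> ?P \<rhd> ?P \<^bold>\<and> ?Q \<in> IL_ext X"
    proof (rule psubset.IH[of "K - {C}"])
      show "K - {C} \<subset> K"
        using \<open>C \<in> K\<close> by blast
      show "?P \<in> BS1" "?Q \<in> BS1"
        using BS1 by (auto intro: BS1.intros)
      show "E \<^bold>\<longrightarrow> ?P \<rhd> ?Q \<in> IL_ext X" "E \<^bold>\<longrightarrow> ?Q \<rhd> ?P \<in> IL_ext X"
        using assms(1) BS1 rhd by (auto intro: rhd_add_box)
    next
      fix v w
      assume "\<forall>C'\<in>K - {C}. v (\<^bold>\<box> C') \<longleftrightarrow> w (\<^bold>\<box> C')"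
        and sat: "peval v (?P \<^bold>\<or> ?Q)" "peval w (?P \<^bold>\<or> ?Q)"
      then have "\<forall>C'\<in>K. v (\<^bold>\<box> C') \<longleftrightarrow> w (\<^bold>\<box> C')"
        by auto
      moreover have "peval v (A \<^bold>\<or> B)" "peval w (A \<^bold>\<or> B)"
        using sat PQ by auto
      ultimately have "(peval v A \<longleftrightarrow> peval w A) \<and> (peval v B \<longleftrightarrow> peval w B)"
        by (rule determined)
      then show "(peval v ?P \<longleftrightarrow> peval w ?P) \<and> (peval v ?Q \<longleftrightarrow> peval w ?Q)"
        using sat PQ by auto
    qed
    moreover have "E \<^bold>\<longrightarrow> ?P \<^bold>\<and> ?Q \<rhd> A \<^bold>\<and> B \<in> IL_ext X"
      using PQ by (intro rhd_if_entails) auto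
    ultimately show ?thesis
      by (rule rhd_trans)
  qed

  show ?case
  proof (cases "\<exists>v. peval v A \<and> \<not> peval v B \<and> (\<forall>C\<in>K. \<not> v (\<^bold>\<box> C))")
    case True
    then obtain v where v: "peval v A" "\<not> peval v B" "\<forall>C\<in>K. \<not> v (\<^bold>\<box> C)"
      by blast
    have "E \<^bold>\<longrightarrow> B \<rhd> A \<^bold>\<and> B \<in> IL_ext X"
    proof (rule rhd_finite_cases[OF \<open>finite K\<close>, where F = "\<lambda>C. B \<^bold>\<and> \<^bold>\<box> C"])
      fix w
      assume w: "peval w B"
      have "\<exists>C\<in>K. w (\<^bold>\<box> C)"
      proof (rule ccontr)
        assume "\<not> (\<exists>C\<in>K. w (\<^bold>\<box> C))"
        then have "peval v B \<longleftrightarrow> peval w B"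
          using determined[of v w] v w by auto
        then show False
          using v w by blast
      qed
      then show "peval w (A \<^bold>\<and> B) \<or> (\<exists>C\<in>K. peval w (B \<^bold>\<and> \<^bold>\<box> C))"
        using w by auto
    qed (use box_true in blast)
    then show ?thesis
      using AB(3) by (blast intro: rhd_trans)
  next
    case False
    show ?thesis
    proof (rule rhd_finite_cases[OF \<open>finite K\<close>, where F = "\<lambda>C. A \<^bold>\<and> \<^bold>\<box> C"])
      fix w
      assume "peval w A"
      then show "peval w (A \<^bold>\<and> B) \<or> (\<exists>C\<in>K. peval w (A \<^bold>\<and> \<^bold>\<box> C))"
        using False by auto
    qed (use box_true in blast)
  qed
qed

theorem theorem7p3:
  fixes A B :: "'v fm"
  assumes "A \<in> BS1" and "B \<in> BS1"
  shows "(A \<^bold>\<equiv> B) \<^bold>\<longrightarrow> (A \<rhd> A \<^bold>\<and> B) \<in> ILB0"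
proof -
  obtain K where K: "finite K"
    "\<And>v w. \<forall>C\<in>K. v (\<^bold>\<box> C) \<longleftrightarrow> w (\<^bold>\<box> C) \<Longrightarrow> peval v A \<longleftrightarrow> peval w A"
    using BS1_finitely_determined[OF assms(1)] by blast
  obtain L where L: "finite L"
    "\<And>v w. \<forall>C\<in>L. v (\<^bold>\<box> C) \<longleftrightarrow> w (\<^bold>\<box> C) \<Longrightarrow> peval v B \<longleftrightarrow> peval w B"
    using BS1_finitely_determined[OF assms(2)] by blast
  show ?thesis
    unfolding ILB0_def
  proof (rule interprets_conjunction[of B0 "K \<union> L"])
    show "(A \<^bold>\<equiv> B) \<^bold>\<longrightarrow> A \<rhd> B \<in> IL_ext B0" "(A \<^bold>\<equiv> B) \<^bold>\<longrightarrow> B \<rhd> A \<in> IL_ext B0"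
      by (rule IL_ext.taut, simp add: tautology_def)+
  next
    fix v w :: "'v fm \<Rightarrow> bool"
    assume "\<forall>C\<in>K \<union> L. v (\<^bold>\<box> C) \<longleftrightarrow> w (\<^bold>\<box> C)"
    then show "(peval v A \<longleftrightarrow> peval w A) \<and> (peval v B \<longleftrightarrow> peval w B)"
      using K(2)[of v w] L(2)[of v w] by auto
  qed (use assms K(1) L(1) in auto)
qed

end
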